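(* Let $G = \mathrm{Homeo}(\mathbb{R} \times \mathbb{R})$ be the group of self-homeomorphisms of the plane. There is an element of $G$ that does not belong to $G_w$ for any word $w \in \{L, R\}^*$.
   Context: $G_L$ is the subgroup of those $g \in G$ that modify only the first coordinate, i.e. for all $(a,b)$ there is $c \in \mathbb{R}$ with $g(a,b) = (c,b)$; $G_R$ is the subgroup of those $g \in G$ that modify only the second coordinate, i.e. for all $(a,b)$ there is $c \in \mathbb{R}$ with $g(a,b) = (a,c)$. For a finite word $w = w_1 w_2 \cdots w_{\ell} \in \{L,R\}^*$, $G_w = G_{w_1} G_{w_2} \cdots G_{w_\ell}$ is the set of all compositions $g_1 g_2 \cdots g_\ell$ with $g_i \in G_{w_i}$ (for the empty word it is the trivial group). *)

theory Defs
  imports "HOL-Analysis.Analysis"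
begin

definition Homeo_plane :: "(real \<times> real \<Rightarrow> real \<times> real) set" where
  "Homeo_plane = {f. \<exists>g. homeomorphism UNIV UNIV f g}"

definition G_L :: "(real \<times> real \<Rightarrow> real \<times> real) set" where
  "G_L = {g \<in> Homeo_plane. \<forall>a b. \<exists>c. g (a, b) = (c, b)}"

definition G_R :: "(real \<times> real \<Rightarrow> real \<times> real) set" where
  "G_R = {g \<in> Homeo_plane. \<forall>a b. \<exists>c. g (a, b) = (a, c)}"

datatype letter = L | R

primrec G_letter :: "letter \<Rightarrow> (real \<times> real \<Rightarrow> real \<times> real) set" where
  "G_letter L = G_L"
| "G_letter R = G_R"

primrec G_word :: "letter list \<Rightarrow> (real \<times> real \<Rightarrow> real \<times> real) set" where
  "G_word [] = {id}"
| "G_word (x # w) = {g \<circ> h | g h. g \<in> G_letter x \<and> h \<in> G_word w}"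

end

theory Submission
  imports Defs
begin

text \<open>Apply \<open>g \<in> G_L\<close> to two distinct points. Their difference \<open>d\<close> keeps its second
coordinate, and when that coordinate is zero the first one keeps its sign (up to a global
reflection). Hence, up to a reflection, the quotient of the new difference by the old one avoids
the negative real axis, and a continuous choice of the angle of \<open>d\<close> changes by less than \<open>\<pi>\<close>.
So along any family of pairs of points, a word map turns a bounded continuous angle into a bounded
continuous angle. The twist that rotates the circle of radius \<open>r\<close> by the angle \<open>r\<close> violates this
for the pairs formed by the origin and \<open>(t, 0)\<close>.\<close>

section \<open>Bounded continuous angles along a family of nonzero complex numbers\<close>

definition bounded_angle :: "'a::topological_space set \<Rightarrow> ('a \<Rightarrow> complex) \<Rightarrow> bool" where
  "bounded_angle T c \<longleftrightarrow>
    (\<exists>\<theta>. continuous_on T \<theta> \<and> bounded (\<theta> ` T) \<and> (\<forall>t\<in>T. cis (\<theta> t) = sgn (c t)))"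

text \<open>The map taking \<open>z\<close> to \<open>cis a * cnj z\<close> is the reflection in the
  line through 0 at angle \<open>a / 2\<close>, so \<open>a - \<theta>\<close> is an angle for the
  image.\<close>

lemma bounded_angle_cnj:
  assumes "bounded_angle T c"
  shows "bounded_angle T (\<lambda>t. cis a * cnj (c t))"
proof -
  obtain \<theta> where \<theta>: "continuous_on T \<theta>" "bounded (\<theta> ` T)" "\<And>t. t \<in> T \<Longrightarrow> cis (\<theta> t) = sgn (c t)"
    using assms unfolding bounded_angle_def by blast
  have "continuous_on T (\<lambda>t. a - \<theta> t)"
    by (intro continuous_intros \<theta>)
  moreover have "bounded ((\<lambda>t. a - \<theta> t) ` T)"
    using \<theta>(2) by (intro bounded_minus_comp) (auto simp: image_constant_conv)
  moreover have "cis (a - \<theta> t) = sgn (cis a * cnj (c t))" if "t \<in> T" for t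
  proof -
    have "cis (a - \<theta> t) = cis a * cnj (cis (\<theta> t))"
      by (simp add: cis_cnj cis_mult)
    also have "\<dots> = sgn (cis a * cnj (c t))"
      unfolding \<theta>(3)[OF that] by (simp add: sgn_eq norm_mult)
    finally show ?thesis .
  qed
  ultimately show ?thesis
    unfolding bounded_angle_def by blast
qed

text \<open>Off the nonpositive real axis \<open>Arg\<close> is continuous and bounded by
  \<open>pi\<close>, so adding \<open>Arg (c' t / c t)\<close> to an angle of \<open>c\<close> gives
  an angle of \<open>c'\<close>.\<close>

lemma bounded_angle_perturb:
  assumes "bounded_angle T c" "continuous_on T c" "continuous_on T c'"
    and quot: "\<And>t. t \<in> T \<Longrightarrow> c' t / c t \<notin> \<real>\<^sub>\<le>\<^sub>0"
  shows "bounded_angle T c'"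
proof -
  obtain \<theta> where \<theta>: "continuous_on T \<theta>" "bounded (\<theta> ` T)" "\<And>t. t \<in> T \<Longrightarrow> cis (\<theta> t) = sgn (c t)"
    using assms(1) unfolding bounded_angle_def by blast
  \<comment> \<open>Division by 0 yields 0, which lies in
    \<open>\<real>\<^sub>\<le>\<^sub>0\<close>, so \<open>quot\<close> rules out zeros of both
    functions.\<close>
  have nz: "c t \<noteq> 0" "c' t / c t \<noteq> 0" if "t \<in> T" for t
    using quot[OF that] by auto
  have "continuous_on T (\<lambda>t. \<theta> t + Arg (c' t / c t))"
    using quot nz by (intro continuous_intros \<theta> assms continuous_on_Arg) auto
  moreover have "bounded ((\<lambda>t. \<theta> t + Arg (c' t / c t)) ` T)"
  proof (rule bounded_plus_comp[OF \<theta>(2)])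
    show "bounded ((\<lambda>t. Arg (c' t / c t)) ` T)"
      unfolding bounded_iff using Arg_bounded
      by (auto intro!: exI[of _ pi] simp: abs_le_iff minus_le_iff less_imp_le)
  qed
  moreover have "cis (\<theta> t + Arg (c' t / c t)) = sgn (c' t)" if "t \<in> T" for t
  proof -
    have "cis (\<theta> t + Arg (c' t / c t)) = sgn (c t) * sgn (c' t / c t)"
      using nz[OF that] by (simp add: cis_mult[symmetric] \<theta>(3)[OF that] cis_Arg)
    also have "\<dots> = sgn (c' t)"
      using nz[OF that] by (simp add: sgn_mult sgn_zero_iff flip: sgn_mult[of "c t" "c' t / c t"])
    finally show ?thesis .
  qed
  ultimately show ?thesis
    unfolding bounded_angle_def by blast
qed

section \<open>Pairs of points under maps of one coordinate\<close>

definition complex_of_pair :: "real \<times> real \<Rightarrow> complex" where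
  "complex_of_pair v = Complex (fst v) (snd v)"

lemma continuous_on_complex_of_pair [continuous_intros]:
  "continuous_on T f \<Longrightarrow> continuous_on T (\<lambda>t. complex_of_pair (f t))"
  unfolding complex_of_pair_def by (intro continuous_intros)

lemma Homeo_plane_continuous:
  "g \<in> Homeo_plane \<Longrightarrow> continuous_on A g"
  unfolding Homeo_plane_def homeomorphism_def
  by (auto intro: continuous_on_subset[where s = UNIV])

lemma Homeo_plane_inj:
  assumes "g \<in> Homeo_plane"
  shows "inj g"
proof -
  obtain h where "homeomorphism UNIV UNIV g h"
    using assms unfolding Homeo_plane_def by blast
  then show ?thesis
    by (intro inj_on_inverseI[of _ h]) (simp add: homeomorphism_apply1)
qed

text \<open>The direction of monotonicity is the same in all rows because the triples with
  \<open>a < a'\<close> form a connected set, on which the difference of first coordinates is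
  continuous and, by injectivity of \<open>g\<close>, never zero.\<close>

lemma G_L_monotone_rows:
  assumes "g \<in> G_L"
  shows "(\<forall>a a' b. a < a' \<longrightarrow> fst (g (a, b)) < fst (g (a', b))) \<or>
         (\<forall>a a' b. a < a' \<longrightarrow> fst (g (a', b)) < fst (g (a, b)))"
proof -
  have hom: "g \<in> Homeo_plane" and snd: "snd (g (a, b)) = b" for a b
    using assms unfolding G_L_def by (auto, metis snd_conv)
  define S :: "(real \<times> real \<times> real) set" where "S = {(a, a', b). a < a'}"
  define F where "F = (\<lambda>(a, a', b). fst (g (a', b)) - fst (g (a, b)))"
  have "convex S"
  proof -
    have "S = {z. (1, - 1, 0) \<bullet> z < 0}"
      by (auto simp: S_def)
    then show ?thesis
      by (simp only: convex_halfspace_lt)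
  qed
  moreover have "continuous_on S F"
    unfolding F_def case_prod_unfold
    by (intro continuous_intros continuous_on_compose2[OF Homeo_plane_continuous[OF hom, of UNIV]]) auto
  ultimately have conn: "connected (F ` S)"
    using connected_continuous_image convex_connected by blast
  have nz: "0 \<notin> F ` S"
  proof
    assume "0 \<in> F ` S"
    then obtain a a' b where "a < a'" "fst (g (a', b)) = fst (g (a, b))"
      unfolding S_def F_def by auto
    then show False
      using injD[OF Homeo_plane_inj[OF hom], of "(a', b)" "(a, b)"] snd by (auto simp: prod_eq_iff)
  qed
  have "(\<forall>s\<in>S. F s > 0) \<or> (\<forall>s\<in>S. F s < 0)"
  proof (rule ccontr)
    assume "\<not> ?thesis"
    then obtain s s' where "s \<in> S" "s' \<in> S" "F s \<le> 0" "0 \<le> F s'"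
      by (meson not_less)
    then show False
      using connectedD_interval[OF conn, of "F s" "F s'" 0] nz by blast
  qed
  then show ?thesis
    unfolding S_def F_def by auto
qed

lemma G_L_bounded_angle:
  assumes g: "g \<in> G_L" and cont: "continuous_on T p" "continuous_on T q"
    and angle: "bounded_angle T (\<lambda>t. complex_of_pair (q t - p t))"
  shows "bounded_angle T (\<lambda>t. complex_of_pair (g (q t) - g (p t)))"
proof -
  have hom: "g \<in> Homeo_plane" and snd: "snd (g x) = snd x" for x
    using g unfolding G_L_def by (auto, metis prod.collapse snd_conv)
  have cont_g: "continuous_on T (\<lambda>t. g (p t))" "continuous_on T (\<lambda>t. g (q t))"
    by (intro continuous_on_compose2[OF Homeo_plane_continuous[OF hom, of UNIV]] cont; simp)+
  \<comment> \<open>\<open>cis\<close> never vanishes whereas \<open>sgn 0 = 0\<close>, so having an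
    angle forces the two points apart.\<close>
  have ne: "q t \<noteq> p t" if "t \<in> T" for t
    using angle that unfolding bounded_angle_def complex_of_pair_def
    by (metis cis_neq_zero diff_self fst_zero snd_zero sgn_zero zero_complex.code)
  \<comment> \<open>If the quotient were a real \<open>r \<le> 0\<close>, comparing second
    coordinates would give \<open>r = 1\<close> when \<open>y \<noteq> 0\<close>; when
    \<open>y = 0\<close>, \<open>x' = r * x\<close> contradicts the sign condition.\<close>
  have quot: "Complex x' y / Complex x y \<notin> \<real>\<^sub>\<le>\<^sub>0"
    if "y = 0 \<Longrightarrow> x * x' > 0" for x x' y :: real
  proof
    assume "Complex x' y / Complex x y \<in> \<real>\<^sub>\<le>\<^sub>0"
    then obtain r where r: "r \<le> 0" "Complex x' y / Complex x y = of_real r"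
      by (auto elim: nonpos_Reals_cases)
    have "Complex x y \<noteq> 0"
      using that by (auto simp: complex_eq_iff)
    with r(2) have "Complex x' y = of_real r * Complex x y"
      by (simp add: field_simps)
    then have "x' = r * x" "y = r * y"
      by (auto simp: complex_eq_iff)
    with r(1) that show False
      by (cases "y = 0") (auto simp: zero_less_mult_iff mult_less_0_iff)
  qed
  consider (inc) "\<And>a a' b. a < a' \<Longrightarrow> fst (g (a, b)) < fst (g (a', b))"
    | (dec) "\<And>a a' b. a < a' \<Longrightarrow> fst (g (a', b)) < fst (g (a, b))"
    using G_L_monotone_rows[OF g] by blast
  then show ?thesis
  proof cases
    case inc
    have "complex_of_pair (g (q t) - g (p t)) / complex_of_pair (q t - p t) \<notin> \<real>\<^sub>\<le>\<^sub>0"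
      if "t \<in> T" for t
      unfolding complex_of_pair_def snd_diff snd
    proof (rule quot)
      assume "snd (q t) - snd (p t) = 0"
      then show "fst (q t - p t) * fst (g (q t) - g (p t)) > 0"
        using ne[OF that] inc[of "fst (q t)" "fst (p t)" "snd (p t)"]
          inc[of "fst (p t)" "fst (q t)" "snd (p t)"]
        by (cases "p t"; cases "q t") (auto simp: zero_less_mult_iff neq_iff)
    qed
    then show ?thesis
      by (intro bounded_angle_perturb[OF angle] continuous_intros cont cont_g)
  next
    case dec
    \<comment> \<open>Reversed rows are handled by negating the first coordinate, which restores the
      sign; reflecting once more in the vertical axis, \<open>cis pi * cnj\<close>, recovers the
      true difference.\<close>
    define c where "c t = Complex (- fst (g (q t) - g (p t))) (snd (g (q t) - g (p t)))" for t
    have "c t / complex_of_pair (q t - p t) \<notin> \<real>\<^sub>\<le>\<^sub>0"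
      if "t \<in> T" for t
      unfolding complex_of_pair_def c_def snd_diff snd
    proof (rule quot)
      assume "snd (q t) - snd (p t) = 0"
      then show "fst (q t - p t) * - fst (g (q t) - g (p t)) > 0"
        using ne[OF that] dec[of "fst (q t)" "fst (p t)" "snd (p t)"]
          dec[of "fst (p t)" "fst (q t)" "snd (p t)"]
        by (cases "p t"; cases "q t") (auto simp: zero_less_mult_iff mult_less_0_iff neq_iff)
    qed
    then have "bounded_angle T c"
      unfolding c_def
      by (intro bounded_angle_perturb[OF angle] continuous_intros cont cont_g)
    then have "bounded_angle T (\<lambda>t. cis pi * cnj (c t))"
      by (rule bounded_angle_cnj)
    moreover have "(\<lambda>t. cis pi * cnj (c t)) = (\<lambda>t. complex_of_pair (g (q t) - g (p t)))"
      by (auto simp: c_def complex_of_pair_def complex_eq_iff)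
    ultimately show ?thesis
      by simp
  qed
qed

section \<open>Transfer to \<open>G_R\<close> by swapping coordinates, and words\<close>

lemma swap_homeomorphism: "homeomorphism UNIV UNIV prod.swap (prod.swap :: real \<times> real \<Rightarrow> _)"
  by (rule homeomorphismI) (simp_all add: continuous_on_swap)

lemma G_R_conj_swap:
  assumes "g \<in> G_R"
  shows "prod.swap \<circ> g \<circ> prod.swap \<in> G_L"
proof -
  obtain h where "homeomorphism UNIV UNIV g h"
    using assms unfolding G_R_def Homeo_plane_def by blast
  then have "prod.swap \<circ> g \<circ> prod.swap \<in> Homeo_plane"
    unfolding Homeo_plane_def using homeomorphism_compose swap_homeomorphism by blast
  moreover have "\<exists>c. (prod.swap \<circ> g \<circ> prod.swap) (a, b) = (c, b)" for a b
    using assms unfolding G_R_def by (auto, metis swap_simp)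
  ultimately show ?thesis
    unfolding G_L_def by blast
qed

text \<open>Swapping coordinates is the reflection in the diagonal, that is, \<open>cnj\<close>
  followed by multiplication by \<open>cis (pi / 2)\<close>.\<close>

lemma bounded_angle_swap:
  assumes "bounded_angle T (\<lambda>t. complex_of_pair (q t - p t))"
  shows "bounded_angle T (\<lambda>t. complex_of_pair (prod.swap (q t) - prod.swap (p t)))"
proof -
  have "(\<lambda>t. cis (pi / 2) * cnj (complex_of_pair (q t - p t))) =
        (\<lambda>t. complex_of_pair (prod.swap (q t) - prod.swap (p t)))"
    by (auto simp: complex_of_pair_def complex_eq_iff)
  then show ?thesis
    using bounded_angle_cnj[OF assms, of "pi / 2"] by simp
qed

lemma G_R_bounded_angle:
  assumes "g \<in> G_R" "continuous_on T p" "continuous_on T q"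
    and "bounded_angle T (\<lambda>t. complex_of_pair (q t - p t))"
  shows "bounded_angle T (\<lambda>t. complex_of_pair (g (q t) - g (p t)))"
proof -
  have "bounded_angle T (\<lambda>t. complex_of_pair
      ((prod.swap \<circ> g \<circ> prod.swap) (prod.swap (q t)) - (prod.swap \<circ> g \<circ> prod.swap) (prod.swap (p t))))"
  proof (rule G_L_bounded_angle[OF G_R_conj_swap[OF assms(1)]])
    show "continuous_on T (\<lambda>t. prod.swap (p t))" "continuous_on T (\<lambda>t. prod.swap (q t))"
      unfolding prod.swap_def by (intro continuous_intros assms)+
  qed (rule bounded_angle_swap[OF assms(4)])
  from bounded_angle_swap[OF this] show ?thesis
    by simp
qed

text \<open>Induction on the word, one letter at a time. Continuity of \<open>f\<close> is carried
  along because the step for the next letter needs continuous curves of image points.\<close>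

lemma G_word_bounded_angle:
  assumes "f \<in> G_word w" "continuous_on T p" "continuous_on T q"
    and "bounded_angle T (\<lambda>t. complex_of_pair (q t - p t))"
  shows "continuous_on UNIV f \<and> bounded_angle T (\<lambda>t. complex_of_pair (f (q t) - f (p t)))"
  using assms(1)
proof (induction w arbitrary: f)
  case Nil
  then show ?case using assms(4) by simp
next
  case (Cons x w)
  then obtain g h where f: "f = g \<circ> h" and g: "g \<in> G_letter x" and "h \<in> G_word w"
    by auto
  then have h: "continuous_on UNIV h" "bounded_angle T (\<lambda>t. complex_of_pair (h (q t) - h (p t)))"
    using Cons.IH by auto
  have "g \<in> Homeo_plane"
    using g by (cases x) (auto simp: G_L_def G_R_def)
  then have "continuous_on UNIV f"
    unfolding f using h(1) Homeo_plane_continuous continuous_on_compose by blast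
  moreover have cont_h: "continuous_on T (\<lambda>t. h (p t))" "continuous_on T (\<lambda>t. h (q t))"
    by (intro continuous_on_compose2[OF h(1)] assms; simp)+
  have "bounded_angle T (\<lambda>t. complex_of_pair (f (q t) - f (p t)))"
  proof (cases x)
    case L
    with g show ?thesis
      using G_L_bounded_angle[OF _ cont_h h(2)] by (simp add: f)
  next
    case R
    with g show ?thesis
      using G_R_bounded_angle[OF _ cont_h h(2)] by (simp add: f)
  qed
  ultimately show ?case ..
qed

text \<open>Two continuous angles of the same curve differ by a constant multiple of
  \<open>2 * pi\<close>, and here \<open>t\<close> itself is an unbounded one.\<close>

lemma spiral_not_bounded_angle:
  assumes "\<And>t. t > 0 \<Longrightarrow> sgn (c t) = cis t"
  shows "\<not> bounded_angle {0::real<..} c"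
proof
  assume "bounded_angle {0<..} c"
  then obtain \<theta> where \<theta>: "continuous_on {0<..} \<theta>" "bounded (\<theta> ` {0<..})"
    "\<And>t. t > 0 \<Longrightarrow> cis (\<theta> t) = cis t"
    using assms unfolding bounded_angle_def by auto
  \<comment> \<open>The number of full turns between the two angles: integer-valued and continuous,
    hence constant.\<close>
  define k where "k t = (\<theta> t - t) / (2 * pi)" for t
  have k_Ints: "k t \<in> \<int>" if "t > 0" for t
  proof -
    have "cis (\<theta> t - t) = 1"
      using \<theta>(3)[OF that] by (simp add: cis_divide[symmetric])
    then have "cos (\<theta> t - t) = 1"
      by (simp add: complex_eq_iff)
    then obtain n :: int where "\<theta> t - t = real_of_int n * 2 * pi"
      using cos_one_2pi_int by blast
    then show ?thesis
      by (simp add: k_def)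
  qed
  have "k constant_on {0<..}"
  proof (rule continuous_discrete_range_constant)
    show "continuous_on {0<..} k"
      unfolding k_def by (intro continuous_intros \<theta>) auto
    have "1 \<le> norm (k y - k x)" if "x > 0" "y > 0" "k y \<noteq> k x" for x y
      using Ints_nonzero_abs_ge1[OF Ints_diff[OF k_Ints k_Ints]] that by simp
    then show "\<exists>e>0. \<forall>y. y \<in> {0<..} \<and> k y \<noteq> k x \<longrightarrow> e \<le> norm (k y - k x)"
      if "x \<in> {0<..}" for x
      using that by (intro exI[of _ 1]) simp
  qed auto
  then obtain n where n: "\<And>t. t > 0 \<Longrightarrow> k t = n"
    unfolding constant_on_def by auto
  obtain B where B: "\<And>t. t > 0 \<Longrightarrow> \<bar>\<theta> t\<bar> \<le> B"
    using \<theta>(2) unfolding bounded_iff by auto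
  \<comment> \<open>Chosen so that \<open>t + 2 * pi * n \<ge> \<bar>B\<bar> + 1\<close>, beyond the
    bound on \<open>\<theta>\<close>.\<close>
  define t where "t = \<bar>B\<bar> + 1 + \<bar>2 * pi * n\<bar>"
  have "t > 0"
    unfolding t_def by linarith
  then have "\<theta> t = t + 2 * pi * n"
    using n[of t] by (simp add: k_def field_simps)
  then show False
    using B[OF \<open>t > 0\<close>] unfolding t_def by linarith
qed

text \<open>Rotation of each circle of radius \<open>r\<close> about the origin by the angle
  \<open>s * r\<close>. The speed \<open>s\<close> is a parameter so that the inverse is again a
  twist.\<close>

definition twist :: "real \<Rightarrow> real \<times> real \<Rightarrow> real \<times> real" where
  "twist s v = (fst v * cos (s * norm v) - snd v * sin (s * norm v),
                fst v * sin (s * norm v) + snd v * cos (s * norm v))"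

lemma norm_twist: "norm (twist s v) = norm v"
proof -
  have "(x * c - y * d)\<^sup>2 + (x * d + y * c)\<^sup>2 = (x\<^sup>2 + y\<^sup>2) * (d\<^sup>2 + c\<^sup>2)" for x y c d :: real
    by algebra
  then show ?thesis
    by (simp add: twist_def norm_prod_def)
qed

text \<open>As the norm is preserved, both twists rotate a given point by opposite angles.\<close>

lemma twist_inverse: "twist (- s) (twist s v) = v"
proof -
  define c d where "c = cos (s * norm v)" and "d = sin (s * norm v)"
  have "c\<^sup>2 + d\<^sup>2 = 1"
    by (simp add: c_def d_def)
  then have "(x * c - y * d) * c + (x * d + y * c) * d = x"
    "(x * d + y * c) * c - (x * c - y * d) * d = y" for x y
    by algebra+
  moreover have "twist (- s) (twist s v) =
    ((fst v * c - snd v * d) * c + (fst v * d + snd v * c) * d,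
     (fst v * d + snd v * c) * c - (fst v * c - snd v * d) * d)"
    unfolding twist_def[of "- s"] norm_twist by (simp add: twist_def c_def d_def)
  ultimately show ?thesis
    by simp
qed

lemma twist_Homeo_plane: "twist s \<in> Homeo_plane"
proof -
  have "continuous_on UNIV (twist s)" for s
    unfolding twist_def by (intro continuous_intros)
  then have "homeomorphism UNIV UNIV (twist s) (twist (- s))"
    using twist_inverse[of s] twist_inverse[of "- s"] by (intro homeomorphismI) auto
  then show ?thesis
    unfolding Homeo_plane_def by blast
qed

theorem theorem8:
  shows "\<exists>f \<in> Homeo_plane. \<forall>w :: letter list. f \<notin> G_word w"
proof (intro bexI allI notI)
  fix w
  assume twist: "twist 1 \<in> G_word w"
  \<comment> \<open>The differences are positive reals, so the constant angle 0 serves.\<close>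
  have "bounded_angle {0<..} (\<lambda>t. complex_of_pair ((t, 0) - (0, 0)))"
    unfolding bounded_angle_def
  proof (intro exI conjI ballI)
    fix t :: real
    assume "t \<in> {0<..}"
    moreover have "complex_of_pair ((t, 0) - (0, 0)) = of_real t"
      by (simp add: complex_of_pair_def complex_eq_iff)
    ultimately show "cis 0 = sgn (complex_of_pair ((t, 0) - (0, 0)))"
      by (simp add: sgn_of_real)
  qed (auto simp: image_constant_conv)
  then have "bounded_angle {0<..} (\<lambda>t. complex_of_pair (twist 1 (t, 0) - twist 1 (0, 0)))"
    using G_word_bounded_angle[OF twist, of "{0<..}" "\<lambda>_. (0, 0)" "\<lambda>t. (t, 0)"]
    by (simp add: continuous_on_Pair)
  \<comment> \<open>\<open>twist 1\<close> fixes the origin and sends \<open>(t, 0)\<close> to the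
    point at distance \<open>t\<close> and angle \<open>t\<close>.\<close>
  moreover have spiral: "sgn (complex_of_pair (twist 1 (t, 0) - twist 1 (0, 0))) = cis t" if "t > 0" for t
  proof -
    have "complex_of_pair (twist 1 (t, 0) - twist 1 (0, 0)) = of_real t * cis t"
      using that by (simp add: complex_of_pair_def twist_def complex_eq_iff norm_Pair)
    then show ?thesis
      using that by (simp add: sgn_mult sgn_of_real)
  qed
  ultimately show False
    using spiral_not_bounded_angle[OF spiral] by simp
qed (rule twist_Homeo_plane)

end
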